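(* Let $\|\cdot\|$ be an arbitrary norm on $\mathbb{R}^d$ and let $A$ be an expanding real $d\times d$ matrix such that $\|\gamma\|\le\|A\gamma\|$ for all $\gamma\in\mathbb{R}^d$. Let $r:[0,\infty)\to\mathbb{R}$ be a continuous decreasing function with $r(0)=1$ and $r(s)\to0$ as $s\to\infty$. Put $\varphi(\gamma):=r(\|\gamma\|)$ and $g(\gamma):=\varphi(\gamma)-\varphi(A\gamma)$ for $\gamma\in\mathbb{R}^d$. Then: (i) $g(\gamma)\ge 0$ for all $\gamma\in\mathbb{R}^d$; (ii) $\sum_{j\in\mathbb{Z}} g(A^j\gamma)=1$ for all $\gamma\in\mathbb{R}^d\setminus\{0\}$; (iii) there exists a constant $C>0$ such that $$C\le\sum_{j\in\mathbb{Z}}|g(A^j\gamma)|^2\le 1\quad\text{for all }\gamma\in\mathbb{R}^d\setminus\{0\}.$$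
   Context: A real $d\times d$ matrix is called expanding if all of its eigenvalues have absolute value strictly greater than one. *)

theory Defs
  imports "HOL-Analysis.Analysis"
begin

text \<open>An arbitrary norm on R^d (d = CARD('n)), given as a function satisfying the norm axioms.\<close>
definition is_norm :: "(real ^ 'n \<Rightarrow> real) \<Rightarrow> bool" where
  "is_norm N \<longleftrightarrow>
     (\<forall>x. 0 \<le> N x) \<and> (\<forall>x. N x = 0 \<longleftrightarrow> x = 0) \<and>
     (\<forall>c x. N (c *\<^sub>R x) = \<bar>c\<bar> * N x) \<and>
     (\<forall>x y. N (x + y) \<le> N x + N y)"

text \<open>Complex eigenvalues of a real square matrix: roots of the characteristic polynomial.\<close>
definition complex_eigenvalue :: "real ^ 'n ^ 'n \<Rightarrow> complex \<Rightarrow> bool" where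
  "complex_eigenvalue A z \<longleftrightarrow>
     det ((\<chi> i j. complex_of_real (A $ i $ j)) - mat z) = 0"

text \<open>A real matrix is expanding if all its (complex) eigenvalues have modulus > 1.\<close>
definition expanding :: "real ^ 'n ^ 'n \<Rightarrow> bool" where
  "expanding A \<longleftrightarrow> (\<forall>z. complex_eigenvalue A z \<longrightarrow> cmod z > 1)"

text \<open>Integer powers A^j applied to a vector (negative powers via the inverse matrix).\<close>
definition matpow_int_v :: "real ^ 'n ^ 'n \<Rightarrow> int \<Rightarrow> real ^ 'n \<Rightarrow> real ^ 'n" where
  "matpow_int_v A j x =
     (if 0 \<le> j then (((*v) A) ^^ nat j) x
      else (((*v) (matrix_inv A)) ^^ nat (- j)) x)"

end

theory Submission
  imports Defs "Jordan_Normal_Form.Spectral_Radius"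
begin

(* Since A is expanding, the eigenvalues of A^-1 lie in the open unit disc, so the powers of
   A^-1 decay geometrically; with the equivalence of norms on R^d this yields an m such that
   N (A^m x) >= 2 N x for all x. The orbit norms s_j = N (A^j x) are nondecreasing in j
   (because N x <= N (A x)), tend to 0 as j -> -oo and to oo as j -> oo. Hence the terms
   g (A^j x) = r s_j - r s_(j+1) are nonnegative and telescope to r 0 - 0 = 1.
   For the lower bound pick a > 0 with r a >= 1/2 and b with r b < 1/4: by the doubling,
   every orbit passes from below a to above b within a number L of steps independent of x,
   so some L consecutive terms sum to at least 1/4, and by Cauchy-Schwarz their squares sum
   to at least 1/(16 L). *)

hide_const (open) Matrix.mat

section \<open>Spectral radius and powers of matrices\<close>

lemma pow_smult_mat:
  fixes A :: "'a :: comm_semiring_1 mat"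
  assumes "A \<in> carrier_mat n n"
  shows "(c \<cdot>\<^sub>m A) ^\<^sub>m k = c ^ k \<cdot>\<^sub>m A ^\<^sub>m k"
proof (induction k)
  case 0
  show ?case using assms by auto
next
  case (Suc k)
  have "(c \<cdot>\<^sub>m A) ^\<^sub>m Suc k = c ^ k \<cdot>\<^sub>m A ^\<^sub>m k * (c \<cdot>\<^sub>m A)"
    by (simp add: Suc.IH)
  also have "\<dots> = c ^ Suc k \<cdot>\<^sub>m A ^\<^sub>m Suc k"
    using assms
    by (intro eq_matI) (auto simp: scalar_prod_def sum_distrib_left ac_simps intro!: sum.cong)
  finally show ?case .
qed

lemma eigenvalue_smult_mat:
  fixes A :: "'a :: comm_ring_1 mat"
  assumes "A \<in> carrier_mat n n" and "eigenvalue A e"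
  shows "eigenvalue (c \<cdot>\<^sub>m A) (c * e)"
proof -
  obtain v where v: "eigenvector A v e" using assms(2) unfolding eigenvalue_def by blast
  then have v_dim: "v \<in> carrier_vec n" and "A *\<^sub>v v = e \<cdot>\<^sub>v v"
    using assms(1) unfolding eigenvector_def by auto
  have "(c \<cdot>\<^sub>m A) *\<^sub>v v = c \<cdot>\<^sub>v (A *\<^sub>v v)"
    using assms(1) v_dim by (intro eq_vecI) (auto simp: scalar_prod_def sum_distrib_left ac_simps)
  also have "\<dots> = (c * e) \<cdot>\<^sub>v v"
    by (simp add: \<open>A *\<^sub>v v = e \<cdot>\<^sub>v v\<close> smult_smult_assoc)
  finally have "(c \<cdot>\<^sub>m A) *\<^sub>v v = (c * e) \<cdot>\<^sub>v v" .
  then show ?thesis using v unfolding eigenvalue_def eigenvector_def by auto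
qed

lemma spectral_radius_less_norm_bound_pow:
  fixes A :: "complex mat"
  assumes A: "A \<in> carrier_mat n n" and sr: "spectral_radius A < \<rho>"
  shows "\<exists>c. \<forall>k. norm_bound (A ^\<^sub>m k) (c * \<rho> ^ k)"
proof (cases "n = 0")
  case True
  then show ?thesis using A by (auto simp: norm_bound_def)
next
  case False
  then have n: "0 < n" by simp
  have "0 \<le> spectral_radius A"
    using spectral_radius_mem_max(1)[OF A n] by auto
  then have \<rho>: "0 < \<rho>" using sr by linarith
  define A' where "A' = complex_of_real (1 / \<rho>) \<cdot>\<^sub>m A"
  have A': "A' \<in> carrier_mat n n" using A by (simp add: A'_def)
  have A_eq: "A = complex_of_real \<rho> \<cdot>\<^sub>m A'"
    using A \<rho> by (intro eq_matI) (auto simp: A'_def)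
  have "spectral_radius A' < 1"
  proof -
    obtain e where e: "eigenvalue A' e" and sr_eq: "spectral_radius A' = cmod e"
      using spectral_radius_mem_max(1)[OF A' n] by (auto simp: spectrum_def)
    have "eigenvalue A (complex_of_real \<rho> * e)"
      using eigenvalue_smult_mat[OF A' e] A_eq by simp
    then have "cmod (complex_of_real \<rho> * e) \<in> norm ` spectrum A"
      by (simp add: spectrum_def)
    then have "cmod (complex_of_real \<rho> * e) \<le> spectral_radius A"
      by (rule spectral_radius_mem_max(2)[OF A n])
    then have "\<rho> * cmod e \<le> spectral_radius A"
      using \<rho> by (simp add: norm_mult)
    with sr have "\<rho> * cmod e < \<rho> * 1" by simp
    then show ?thesis
      unfolding sr_eq by (rule mult_less_cancel_left_pos[THEN iffD1, OF \<rho>])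
  qed
  then obtain c where c: "\<And>k. norm_bound (A' ^\<^sub>m k) c"
    using spectral_radius_jnf_norm_bound_less_1_upper_triangular[OF A'] by blast
  have "norm_bound (A ^\<^sub>m k) (c * \<rho> ^ k)" for k
    using c[of k] \<rho> unfolding A_eq pow_smult_mat[OF A'] norm_bound_def
    by (auto simp: norm_mult norm_power mult.commute mult_left_mono)
  then show ?thesis by blast
qed

(* The spectral theory of Jordan_Normal_Form lives on its own matrix type 'a mat, indexed by
   natural numbers; a bijection ix from the finite index type onto {0..<CARD('n)} transports
   matrices and vectors of HOL-Analysis there. *)

definition jnf_of_hma_mat :: "('n \<Rightarrow> nat) \<Rightarrow> 'a ^ 'n ^ 'n \<Rightarrow> 'a mat" where
  "jnf_of_hma_mat ix M = Matrix.mat CARD('n) CARD('n)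
     (\<lambda>(i, j). vec_nth (vec_nth M (inv_into UNIV ix i)) (inv_into UNIV ix j))"

definition jnf_of_hma_vec :: "('n \<Rightarrow> nat) \<Rightarrow> 'a ^ 'n \<Rightarrow> 'a Matrix.vec" where
  "jnf_of_hma_vec ix v = Matrix.vec CARD('n) (\<lambda>i. vec_nth v (inv_into UNIV ix i))"

lemma index_bij_facts:
  assumes "bij_betw (ix :: 'n :: finite \<Rightarrow> nat) UNIV {0..<CARD('n)}"
  shows "\<And>x. inv_into UNIV ix (ix x) = x"
    and "\<And>i. i < CARD('n) \<Longrightarrow> ix (inv_into UNIV ix i) = i"
    and "\<And>x. ix x < CARD('n)"
    and "bij_betw (inv_into UNIV ix) {0..<CARD('n)} UNIV"
  using bij_betw_inv_into_left[OF assms] bij_betw_inv_into_right[OF assms]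
    bij_betwE[OF assms] bij_betw_inv_into[OF assms] by auto

lemma jnf_of_hma_mat_mult_vec:
  fixes M :: "'a :: comm_semiring_1 ^ 'n ^ 'n"
  assumes ix: "bij_betw ix UNIV {0..<CARD('n)}"
  shows "jnf_of_hma_mat ix M *\<^sub>v jnf_of_hma_vec ix w = jnf_of_hma_vec ix (M *v w)"
proof (rule eq_vecI)
  fix i assume "i < dim_vec (jnf_of_hma_vec ix (M *v w))"
  then have i: "i < CARD('n)" by (simp add: jnf_of_hma_vec_def)
  have "vec_index (jnf_of_hma_mat ix M *\<^sub>v jnf_of_hma_vec ix w) i
      = (\<Sum>j = 0..<CARD('n). vec_nth (vec_nth M (inv_into UNIV ix i)) (inv_into UNIV ix j)
          * vec_nth w (inv_into UNIV ix j))"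
    using i by (simp add: jnf_of_hma_mat_def jnf_of_hma_vec_def scalar_prod_def)
  also have "\<dots> = (\<Sum>x\<in>UNIV. vec_nth (vec_nth M (inv_into UNIV ix i)) x * vec_nth w x)"
    by (rule sum.reindex_bij_betw[OF index_bij_facts(4)[OF ix]])
  finally show "vec_index (jnf_of_hma_mat ix M *\<^sub>v jnf_of_hma_vec ix w) i
      = vec_index (jnf_of_hma_vec ix (M *v w)) i"
    using i by (simp add: jnf_of_hma_vec_def matrix_vector_mult_def)
qed (simp add: jnf_of_hma_mat_def jnf_of_hma_vec_def)

lemma jnf_of_hma_vec_inverse:
  fixes ix :: "'n :: finite \<Rightarrow> nat"
  assumes ix: "bij_betw ix UNIV {0..<CARD('n)}" and v: "v \<in> carrier_vec CARD('n)"
  shows "jnf_of_hma_vec ix (\<chi> x :: 'n. vec_index v (ix x)) = v"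
  using v index_bij_facts[OF ix] by (intro eq_vecI) (auto simp: jnf_of_hma_vec_def)

lemma jnf_of_hma_vec_eq_iff:
  fixes ix :: "'n :: finite \<Rightarrow> nat"
  assumes ix: "bij_betw ix UNIV {0..<CARD('n)}"
  shows "jnf_of_hma_vec ix v = jnf_of_hma_vec ix w \<longleftrightarrow> v = w"
proof
  assume "jnf_of_hma_vec ix v = jnf_of_hma_vec ix w"
  then have "vec_index (jnf_of_hma_vec ix v) (ix x) = vec_index (jnf_of_hma_vec ix w) (ix x)" for x
    by simp
  then show "v = w"
    using index_bij_facts[OF ix]
    by (simp add: jnf_of_hma_vec_def Finite_Cartesian_Product.vec_eq_iff)
qed simp

lemma jnf_of_hma_vec_nth:
  assumes ix: "bij_betw ix UNIV {0..<CARD('n)}"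
  shows "vec_index (jnf_of_hma_vec ix v) (ix x) = vec_nth v (x :: 'n :: finite)"
  using index_bij_facts[OF ix] by (simp add: jnf_of_hma_vec_def)

lemma jnf_of_hma_vec_smult: "jnf_of_hma_vec ix (c *s v) = c \<cdot>\<^sub>v jnf_of_hma_vec ix v"
  by (auto simp: jnf_of_hma_vec_def)

lemma jnf_of_hma_vec_zero: "jnf_of_hma_vec (ix :: 'n :: finite \<Rightarrow> nat) 0 = 0\<^sub>v CARD('n)"
  by (auto simp: jnf_of_hma_vec_def)

lemma eigenvalue_jnf_of_hma_mat_iff:
  fixes M :: "'a :: comm_ring_1 ^ 'n ^ 'n"
  assumes ix: "bij_betw ix UNIV {0..<CARD('n)}"
  shows "eigenvalue (jnf_of_hma_mat ix M) e \<longleftrightarrow> (\<exists>w. w \<noteq> 0 \<and> M *v w = e *s w)"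
proof
  assume "eigenvalue (jnf_of_hma_mat ix M) e"
  then obtain v where v: "v \<in> carrier_vec CARD('n)" "v \<noteq> 0\<^sub>v CARD('n)"
    and ev: "jnf_of_hma_mat ix M *\<^sub>v v = e \<cdot>\<^sub>v v"
    by (auto simp: eigenvalue_def eigenvector_def jnf_of_hma_mat_def)
  define w where "w = (\<chi> x :: 'n. vec_index v (ix x))"
  have v_eq: "v = jnf_of_hma_vec ix w"
    unfolding w_def by (rule jnf_of_hma_vec_inverse[OF ix v(1), symmetric])
  have "w \<noteq> 0" using v(2) by (auto simp: v_eq jnf_of_hma_vec_zero)
  moreover have "M *v w = e *s w"
    using ev unfolding v_eq jnf_of_hma_mat_mult_vec[OF ix] jnf_of_hma_vec_smult[symmetric]
    by (simp add: jnf_of_hma_vec_eq_iff[OF ix])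
  ultimately show "\<exists>w. w \<noteq> 0 \<and> M *v w = e *s w" by blast
next
  assume "\<exists>w. w \<noteq> 0 \<and> M *v w = e *s w"
  then obtain w where "w \<noteq> 0" "M *v w = e *s w" by blast
  moreover have "jnf_of_hma_vec ix w \<noteq> 0\<^sub>v CARD('n)"
    using \<open>w \<noteq> 0\<close> jnf_of_hma_vec_eq_iff[OF ix, of w 0] by (simp add: jnf_of_hma_vec_zero)
  ultimately have "eigenvector (jnf_of_hma_mat ix M) (jnf_of_hma_vec ix w) e"
    by (auto simp: eigenvector_def jnf_of_hma_mat_mult_vec[OF ix] jnf_of_hma_vec_smult)
      (auto simp: jnf_of_hma_mat_def jnf_of_hma_vec_def)
  then show "eigenvalue (jnf_of_hma_mat ix M) e" unfolding eigenvalue_def by blast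
qed

lemma jnf_of_hma_vec_iterate:
  fixes M :: "'a :: comm_semiring_1 ^ 'n ^ 'n"
  assumes ix: "bij_betw ix UNIV {0..<CARD('n)}"
  shows "jnf_of_hma_vec ix ((((*v) M) ^^ k) w)
    = jnf_of_hma_mat ix M ^\<^sub>m k *\<^sub>v jnf_of_hma_vec ix w"
proof (induction k arbitrary: w)
  case 0
  show ?case by (simp add: jnf_of_hma_mat_def jnf_of_hma_vec_def)
next
  case (Suc k)
  have J: "jnf_of_hma_mat ix M \<in> carrier_mat CARD('n) CARD('n)"
    by (simp add: jnf_of_hma_mat_def)
  have "jnf_of_hma_vec ix ((((*v) M) ^^ Suc k) w)
      = jnf_of_hma_vec ix ((((*v) M) ^^ k) (M *v w))"
    by (simp only: funpow_Suc_right comp_def)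
  also have "\<dots>
      = jnf_of_hma_mat ix M ^\<^sub>m k *\<^sub>v (jnf_of_hma_mat ix M *\<^sub>v jnf_of_hma_vec ix w)"
    by (simp add: Suc.IH jnf_of_hma_mat_mult_vec[OF ix])
  also have "\<dots> = jnf_of_hma_mat ix M ^\<^sub>m Suc k *\<^sub>v jnf_of_hma_vec ix w"
    using J
    by (simp add: assoc_mult_mat_vec[of _ "CARD('n)" "CARD('n)" _ "CARD('n)"] jnf_of_hma_vec_def)
  finally show ?case .
qed

lemma norm_bound_mult_vec:
  fixes P :: "'a :: real_normed_field mat"
  assumes P: "P \<in> carrier_mat n n" and c: "norm_bound P c"
    and v: "v \<in> carrier_vec n" and i: "i < n"
  shows "norm (vec_index (P *\<^sub>v v) i) \<le> c * (\<Sum>j<n. norm (vec_index v j))"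
proof -
  have "norm (vec_index (P *\<^sub>v v) i) = norm (\<Sum>j<n. P $$ (i, j) * vec_index v j)"
    using P v i by (simp add: scalar_prod_def atLeast0LessThan)
  also have "\<dots> \<le> (\<Sum>j<n. norm (P $$ (i, j)) * norm (vec_index v j))"
    by (rule order_trans[OF norm_sum]) (simp add: norm_mult)
  also have "\<dots> \<le> (\<Sum>j<n. c * norm (vec_index v j))"
    using c P i by (intro sum_mono mult_right_mono) (auto simp: norm_bound_def)
  finally show ?thesis by (simp add: sum_distrib_left)
qed

lemma norm_bound_nonneg:
  assumes "norm_bound P c" and "P \<in> carrier_mat n n" and "0 < n"
  shows "0 \<le> c"
  using assms unfolding norm_bound_def by (metis carrier_matD norm_ge_zero order_trans)

lemma sum_norm_nth_le:
  "(\<Sum>i\<in>UNIV. norm (v $ i)) \<le> CARD('n) * norm (v :: 'a :: real_normed_vector ^ 'n)"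
proof -
  have "(\<Sum>i\<in>UNIV. norm (v $ i)) \<le> (\<Sum>i\<in>(UNIV :: 'n set). norm v)"
    by (intro sum_mono Finite_Cartesian_Product.norm_nth_le)
  then show ?thesis by simp
qed

lemma norm_le_sum_norm_nth:
  "norm (v :: 'a :: real_normed_vector ^ 'n) \<le> (\<Sum>i\<in>UNIV. norm (v $ i))"
  unfolding norm_vec_def by (rule L2_set_le_sum) simp

lemma complex_matrix_iterate_decay:
  fixes M :: "complex ^ 'n ^ 'n"
  assumes eig: "\<And>w e. w \<noteq> 0 \<Longrightarrow> M *v w = e *s w \<Longrightarrow> cmod e < 1"
  shows "\<exists>c \<rho>. 0 < \<rho> \<and> \<rho> < 1 \<and>
    (\<forall>k w. norm ((((*v) M) ^^ k) w) \<le> c * \<rho> ^ k * norm w)"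
proof -
  obtain ix :: "'n \<Rightarrow> nat" where ix: "bij_betw ix UNIV {0..<CARD('n)}"
    using ex_bij_betw_finite_nat[of "UNIV :: 'n set"] by auto
  let ?n = "CARD('n)"
  define J where "J = jnf_of_hma_mat ix M"
  have J: "J \<in> carrier_mat ?n ?n" by (simp add: J_def jnf_of_hma_mat_def)
  obtain e where "eigenvalue J e" "spectral_radius J = cmod e"
    using spectral_radius_mem_max(1)[OF J] by (auto simp: spectrum_def)
  then have sr: "spectral_radius J < 1" and sr_nonneg: "0 \<le> spectral_radius J"
    using eig by (auto simp: J_def eigenvalue_jnf_of_hma_mat_iff[OF ix])
  define \<rho> where "\<rho> = (1 + spectral_radius J) / 2"
  have \<rho>: "0 < \<rho>" "\<rho> < 1" "spectral_radius J < \<rho>"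
    using sr sr_nonneg by (auto simp: \<rho>_def)
  obtain c where c: "\<And>k. norm_bound (J ^\<^sub>m k) (c * \<rho> ^ k)"
    using spectral_radius_less_norm_bound_pow[OF J \<rho>(3)] by blast
  have "norm ((((*v) M) ^^ k) w) \<le> (?n * c * ?n) * \<rho> ^ k * norm w" for k w
  proof -
    have entry: "norm (((((*v) M) ^^ k) w) $ x) \<le> c * \<rho> ^ k * (?n * norm w)" for x
    proof -
      have "norm (((((*v) M) ^^ k) w) $ x)
          = norm (vec_index (J ^\<^sub>m k *\<^sub>v jnf_of_hma_vec ix w) (ix x))"
        by (simp add: J_def jnf_of_hma_vec_nth[OF ix, symmetric] jnf_of_hma_vec_iterate[OF ix])
      also have "\<dots> \<le> c * \<rho> ^ k * (\<Sum>j<?n. norm (vec_index (jnf_of_hma_vec ix w) j))"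
        using J c index_bij_facts(3)[OF ix]
        by (intro norm_bound_mult_vec) (auto simp: jnf_of_hma_vec_def)
      also have "(\<Sum>j<?n. norm (vec_index (jnf_of_hma_vec ix w) j))
          = (\<Sum>x\<in>UNIV. norm (w $ x))"
        using sum.reindex_bij_betw[OF index_bij_facts(4)[OF ix], of "\<lambda>x. norm (w $ x)"]
        by (simp add: jnf_of_hma_vec_def atLeast0LessThan)
      also have "\<dots> \<le> ?n * norm w" by (rule sum_norm_nth_le)
      finally show ?thesis
        using norm_bound_nonneg[OF c pow_carrier_mat[OF J]] by (simp add: mult_left_mono)
    qed
    have "norm ((((*v) M) ^^ k) w) \<le> (\<Sum>x\<in>UNIV. norm (((((*v) M) ^^ k) w) $ x))"
      by (rule norm_le_sum_norm_nth)
    also have "\<dots> \<le> ?n * (c * \<rho> ^ k * (?n * norm w))"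
      using sum_mono[of UNIV, OF entry] by simp
    finally show ?thesis by (simp add: ac_simps)
  qed
  with \<rho> show ?thesis by blast
qed

section \<open>Expanding matrices\<close>

definition complexify_vec :: "real ^ 'n \<Rightarrow> complex ^ 'n" where
  "complexify_vec y = (\<chi> i. complex_of_real (y $ i))"

definition complexify_mat :: "real ^ 'n ^ 'm \<Rightarrow> complex ^ 'n ^ 'm" where
  "complexify_mat M = (\<chi> i j. complex_of_real (M $ i $ j))"

lemma complexify_mat_mult_vec: "complexify_mat M *v complexify_vec y = complexify_vec (M *v y)"
  by (simp add: complexify_mat_def complexify_vec_def matrix_vector_mult_def vec_eq_iff)

lemma complexify_mat_mult: "complexify_mat (M ** P) = complexify_mat M ** complexify_mat P"
  by (simp add: complexify_mat_def matrix_matrix_mult_def vec_eq_iff)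

lemma complexify_mat_one:
  "complexify_mat (mat 1) = mat 1"
  by (simp add: complexify_mat_def Finite_Cartesian_Product.mat_def
      Finite_Cartesian_Product.vec_eq_iff)

lemma complexify_vec_eq_0_iff [simp]: "complexify_vec x = 0 \<longleftrightarrow> x = 0"
  by (simp add: complexify_vec_def Finite_Cartesian_Product.vec_eq_iff)

lemma norm_complexify_vec: "norm (complexify_vec y) = norm y"
  by (simp add: complexify_vec_def norm_vec_def)

lemma real_matrix_iterate_decay:
  fixes B :: "real ^ 'n ^ 'n"
  assumes "\<And>w e. w \<noteq> 0 \<Longrightarrow> complexify_mat B *v w = e *s w \<Longrightarrow> cmod e < 1"
  shows "\<exists>c \<rho>. 0 < \<rho> \<and> \<rho> < 1 \<and>
    (\<forall>k y. norm ((((*v) B) ^^ k) y) \<le> c * \<rho> ^ k * norm y)"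
proof -
  have iterate:
    "complexify_vec ((((*v) B) ^^ k) y) = (((*v) (complexify_mat B)) ^^ k) (complexify_vec y)"
    for k y by (induction k) (simp_all add: complexify_mat_mult_vec[symmetric])
  have "\<exists>c \<rho>. 0 < \<rho> \<and> \<rho> < 1 \<and>
      (\<forall>k w. norm ((((*v) (complexify_mat B)) ^^ k) w) \<le> c * \<rho> ^ k * norm w)"
    by (rule complex_matrix_iterate_decay) (rule assms)
  then obtain c \<rho> where "0 < \<rho>" "\<rho> < 1"
    and "\<And>k w. norm ((((*v) (complexify_mat B)) ^^ k) w) \<le> c * \<rho> ^ k * norm w"
    by blast
  then show ?thesis
    by (metis iterate norm_complexify_vec)
qed

lemma complex_eigenvalueI:
  assumes "w \<noteq> 0" and "complexify_mat A *v w = z *s w"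
  shows "complex_eigenvalue A z"
proof -
  have "mat z *v w = z *s w"
    by (simp add: Finite_Cartesian_Product.mat_def matrix_vector_mult_def
        Finite_Cartesian_Product.vec_eq_iff
        if_distrib[of "\<lambda>x. x * y" for y] cong: if_cong)
  then have "(complexify_mat A - mat z) *v w = 0"
    using assms(2) by (simp add: matrix_vector_mult_diff_rdistrib)
  then have "\<not> invertible (complexify_mat A - mat z)"
    using assms(1) unfolding invertible_left_inverse matrix_left_invertible_ker by blast
  then show ?thesis
    unfolding complex_eigenvalue_def complexify_mat_def[symmetric]
    using invertible_det_nz by blast
qed

lemma expanding_invertible:
  assumes "expanding A"
  shows "invertible A"
proof (rule ccontr)
  assume "\<not> invertible A"
  then obtain x where "A *v x = 0" "x \<noteq> 0"
    unfolding invertible_left_inverse matrix_left_invertible_ker by blast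
  then have "complexify_vec x \<noteq> 0" "complexify_mat A *v complexify_vec x = 0 *s complexify_vec x"
    by (simp_all add: complexify_mat_mult_vec)
  then have "complex_eigenvalue A 0" by (rule complex_eigenvalueI)
  then show False using assms unfolding expanding_def by fastforce
qed

lemma matrix_inv_both_sides:
  assumes "invertible A"
  shows "A ** matrix_inv A = mat 1"
    and "matrix_inv A ** A = mat 1"
proof -
  have "\<exists>A'. A ** A' = mat 1 \<and> A' ** A = mat 1"
    using assms unfolding invertible_def .
  then have "A ** matrix_inv A = mat 1 \<and> matrix_inv A ** A = mat 1"
    unfolding matrix_inv_def by (rule someI_ex)
  then show "A ** matrix_inv A = mat 1"
    and "matrix_inv A ** A = mat 1" by auto
qed

lemma matrix_inv_iterate_cancel:
  fixes A :: "'a :: field ^ 'n ^ 'n"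
  assumes "invertible A"
  shows "(((*v) (matrix_inv A)) ^^ k) ((((*v) A) ^^ k) x) = x"
proof (induction k arbitrary: x)
  case (Suc k)
  have "(((*v) (matrix_inv A)) ^^ Suc k) ((((*v) A) ^^ Suc k) x)
      = (((*v) (matrix_inv A)) ^^ k) (matrix_inv A *v (A *v (((*v) A) ^^ k) x))"
    by (simp only: funpow_Suc_right[where f = "(*v) (matrix_inv A)"]
        funpow.simps(2)[where f = "(*v) A"] comp_def)
  then show ?case
    by (simp add: matrix_vector_mul_assoc matrix_inv_both_sides(2)[OF assms] Suc.IH)
qed simp

lemma matrix_vector_mult_smult: "M *v (c *s w) = c *s (M *v w :: 'a :: comm_semiring_1 ^ 'm)"
  by (simp add: matrix_vector_mult_def Finite_Cartesian_Product.vec_eq_iff sum_distrib_left ac_simps)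

lemma expanding_inverse_eigenvalue:
  assumes A: "expanding A" and w: "w \<noteq> 0"
    and ev: "complexify_mat (matrix_inv A) *v w = e *s w"
  shows "cmod e < 1"
proof -
  have "w = complexify_mat (A ** matrix_inv A) *v w"
    by (simp add: matrix_inv_both_sides(1)[OF expanding_invertible[OF A]] complexify_mat_one)
  also have "\<dots> = e *s (complexify_mat A *v w)"
    by (simp add: complexify_mat_mult matrix_vector_mul_assoc[symmetric] ev
        matrix_vector_mult_smult)
  finally have w_eq: "w = e *s (complexify_mat A *v w)" .
  then have "e \<noteq> 0" using w by auto
  have "inverse e *s w = inverse e *s (e *s (complexify_mat A *v w))"
    using w_eq by (rule arg_cong)
  with \<open>e \<noteq> 0\<close> have "complexify_mat A *v w = inverse e *s w"
    by (simp add: vector_smult_assoc)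
  then have "1 < cmod (inverse e)"
    using A complex_eigenvalueI[OF w] unfolding expanding_def by blast
  with \<open>e \<noteq> 0\<close> show ?thesis by (simp add: norm_inverse one_less_inverse_iff)
qed

lemma expanding_iterate_growth:
  assumes A: "expanding A"
  shows "\<exists>c \<rho>. 0 < \<rho> \<and> \<rho> < 1 \<and>
    (\<forall>k x. norm x \<le> c * \<rho> ^ k * norm ((((*v) A) ^^ k) x))"
proof -
  have "\<exists>c \<rho>. 0 < \<rho> \<and> \<rho> < 1 \<and>
      (\<forall>k y. norm ((((*v) (matrix_inv A)) ^^ k) y) \<le> c * \<rho> ^ k * norm y)"
    by (rule real_matrix_iterate_decay) (rule expanding_inverse_eigenvalue[OF A])
  then show ?thesis
    by (metis matrix_inv_iterate_cancel[OF expanding_invertible[OF A]])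
qed

section \<open>Norms on real vectors\<close>

lemma is_norm_nonneg: "is_norm N \<Longrightarrow> 0 \<le> N x"
  by (simp add: is_norm_def)

lemma is_norm_pos: "is_norm N \<Longrightarrow> x \<noteq> 0 \<Longrightarrow> 0 < N x"
  by (simp add: is_norm_def order_less_le)

lemma is_norm_zero: "is_norm N \<Longrightarrow> N 0 = 0"
  by (simp add: is_norm_def)

lemma is_norm_scaleR: "is_norm N \<Longrightarrow> N (c *\<^sub>R x) = \<bar>c\<bar> * N x"
  by (simp add: is_norm_def)

lemma is_norm_triangle: "is_norm N \<Longrightarrow> N (x + y) \<le> N x + N y"
  by (simp add: is_norm_def)

lemma is_norm_diff: "is_norm N \<Longrightarrow> \<bar>N x - N y\<bar> \<le> N (x - y)"
  using is_norm_triangle[of N "x - y" y] is_norm_triangle[of N "y - x" x]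
    is_norm_scaleR[of N "-1" "x - y"]
  by (simp add: abs_le_iff)

lemma is_norm_sum_le:
  assumes "is_norm N"
  shows "N (\<Sum>i\<in>S. f i) \<le> (\<Sum>i\<in>S. N (f i))"
proof (induction S rule: infinite_finite_induct)
  case (insert x F)
  then show ?case using is_norm_triangle[OF assms, of "f x" "sum f F"] by simp
qed (simp_all add: is_norm_zero[OF assms])

lemma is_norm_le_norm:
  fixes N :: "real ^ 'n \<Rightarrow> real"
  assumes N: "is_norm N"
  shows "\<exists>K\<ge>0. \<forall>x. N x \<le> K * norm x"
proof -
  define K where "K = (\<Sum>i\<in>UNIV. N (axis i 1)) * CARD('n)"
  have "N x \<le> K * norm x" for x
  proof -
    have "N x = N (\<Sum>i\<in>UNIV. x $ i *\<^sub>R axis i 1)"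
      by (metis (no_types) basis_expansion scalar_mult_eq_scaleR)
    also have "\<dots> \<le> (\<Sum>i\<in>UNIV. \<bar>x $ i\<bar> * N (axis i 1))"
      using is_norm_sum_le[OF N, of "\<lambda>i. x $ i *\<^sub>R axis i 1" UNIV]
      by (simp add: is_norm_scaleR[OF N])
    also have "\<dots> \<le> (\<Sum>i\<in>(UNIV :: 'n set). norm x * (\<Sum>j\<in>UNIV. N (axis j 1)))"
      using is_norm_nonneg[OF N]
      by (intro sum_mono mult_mono component_le_norm_cart member_le_sum) (auto simp: sum_nonneg)
    finally show ?thesis by (simp add: K_def ac_simps)
  qed
  moreover have "0 \<le> K" using is_norm_nonneg[OF N] by (simp add: K_def sum_nonneg)
  ultimately show ?thesis by blast
qed

lemma is_norm_ge_norm: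
  fixes N :: "real ^ 'n \<Rightarrow> real"
  assumes N: "is_norm N"
  shows "\<exists>m>0. \<forall>x. m * norm x \<le> N x"
proof -
  obtain K where K: "\<And>x. N x \<le> K * norm x" using is_norm_le_norm[OF N] by blast
  have "continuous_on (sphere 0 1) N"
  proof (rule lipschitz_on_continuous_on)
    show "\<bar>K\<bar>-lipschitz_on (sphere 0 1) N"
    proof (rule lipschitz_onI)
      fix x y :: "real ^ 'n"
      have "dist (N x) (N y) \<le> K * norm (x - y)"
        using is_norm_diff[OF N, of x y] K[of "x - y"] by (simp add: dist_real_def)
      then show "dist (N x) (N y) \<le> \<bar>K\<bar> * dist x y"
        by (smt (verit) dist_norm mult_right_mono norm_ge_zero)
    qed simp
  qed
  moreover have "sphere (0 :: real ^ 'n) 1 \<noteq> {}"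
    using norm_axis_1 by (metis mem_sphere_0 empty_iff)
  ultimately obtain x0 where x0: "x0 \<in> sphere 0 1"
    and min: "\<And>y. y \<in> sphere 0 1 \<Longrightarrow> N x0 \<le> N y"
    using continuous_attains_inf[OF compact_sphere] by blast
  have "N x0 * norm x \<le> N x" for x
  proof (cases "x = 0")
    case False
    then have "N x0 \<le> N ((1 / norm x) *\<^sub>R x)" by (intro min) simp
    with False show ?thesis by (simp add: is_norm_scaleR[OF N] field_simps)
  qed (simp add: is_norm_zero[OF N])
  moreover have "0 < N x0" using x0 by (intro is_norm_pos[OF N]) auto
  ultimately show ?thesis by blast
qed

lemma expanding_norm_iterate_bound:
  fixes N :: "real ^ 'n \<Rightarrow> real"
  assumes N: "is_norm N" and A: "expanding A"
  shows "\<exists>D \<rho>. 0 \<le> D \<and> 0 < \<rho> \<and> \<rho> < 1 \<and>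
    (\<forall>k x. N x \<le> D * \<rho> ^ k * N ((((*v) A) ^^ k) x))"
proof -
  obtain c \<rho> where \<rho>: "0 < \<rho>" "\<rho> < 1"
    and growth: "\<And>k x. norm x \<le> c * \<rho> ^ k * norm ((((*v) A) ^^ k) x)"
    using expanding_iterate_growth[OF A] by blast
  obtain K where K: "0 \<le> K" "\<And>x. N x \<le> K * norm x" using is_norm_le_norm[OF N] by blast
  obtain m where m: "0 < m" "\<And>x. m * norm x \<le> N x" using is_norm_ge_norm[OF N] by blast
  have "N x \<le> (K * \<bar>c\<bar> / m) * \<rho> ^ k * N ((((*v) A) ^^ k) x)" for k x
  proof -
    let ?y = "(((*v) A) ^^ k) x"
    have "norm x \<le> c * \<rho> ^ k * norm ?y" by (rule growth)
    also have "\<dots> \<le> \<bar>c\<bar> * \<rho> ^ k * norm ?y"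
      using \<rho> by (intro mult_right_mono) auto
    also have "\<dots> \<le> \<bar>c\<bar> * \<rho> ^ k * (N ?y / m)"
      using m \<rho> by (intro mult_left_mono) (auto simp: le_divide_eq mult.commute)
    finally have "K * norm x \<le> K * (\<bar>c\<bar> * \<rho> ^ k * (N ?y / m))"
      using K(1) by (rule mult_left_mono)
    then show ?thesis using K(2)[of x] by simp
  qed
  moreover have "0 \<le> K * \<bar>c\<bar> / m" using K m by simp
  ultimately show ?thesis using \<rho> by blast
qed

lemma expanding_iterate_norm_ge:
  fixes N :: "real ^ 'n \<Rightarrow> real"
  assumes N: "is_norm N" and A: "expanding A"
  shows "\<exists>k. \<forall>x. M * N x \<le> N ((((*v) A) ^^ k) x)"
proof -
  obtain D \<rho> where D: "0 \<le> D" and \<rho>: "0 < \<rho>" "\<rho> < 1"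
    and bound: "\<And>k x. N x \<le> D * \<rho> ^ k * N ((((*v) A) ^^ k) x)"
    using expanding_norm_iterate_bound[OF N A] by blast
  have pos: "0 < \<bar>M\<bar> * D + 1" using D by (simp add: add_nonneg_pos)
  then have "0 < 1 / (\<bar>M\<bar> * D + 1)" by simp
  then obtain k where k: "\<rho> ^ k < 1 / (\<bar>M\<bar> * D + 1)"
    using real_arch_pow_inv[OF _ \<rho>(2)] by blast
  have small: "\<bar>M\<bar> * D * \<rho> ^ k \<le> 1"
  proof -
    have "\<rho> ^ k * (\<bar>M\<bar> * D + 1) < 1"
      using k by (simp only: pos_less_divide_eq[OF pos])
    moreover have "\<bar>M\<bar> * D * \<rho> ^ k \<le> \<rho> ^ k * (\<bar>M\<bar> * D + 1)"
      using \<rho> by (simp add: algebra_simps)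
    ultimately show ?thesis by linarith
  qed
  have "M * N x \<le> N ((((*v) A) ^^ k) x)" for x
  proof -
    let ?y = "(((*v) A) ^^ k) x"
    have "M * N x \<le> \<bar>M\<bar> * N x" using is_norm_nonneg[OF N] by (intro mult_right_mono) auto
    also have "\<dots> \<le> \<bar>M\<bar> * (D * \<rho> ^ k * N ?y)" by (intro mult_left_mono bound) simp
    also have "\<dots> = (\<bar>M\<bar> * D * \<rho> ^ k) * N ?y" by simp
    also have "\<dots> \<le> N ?y"
      using mult_left_le[OF small is_norm_nonneg[OF N]] by (simp add: mult.commute)
    finally show ?thesis .
  qed
  then show ?thesis by blast
qed

section \<open>Integer powers and sums over the integers\<close>

lemma matpow_int_v_of_nat [simp]: "matpow_int_v A (int k) x = (((*v) A) ^^ k) x"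
  by (simp add: matpow_int_v_def)

lemma matpow_int_v_zero [simp]: "matpow_int_v A 0 x = x"
  by (simp add: matpow_int_v_def)

lemma matpow_int_v_uminus_of_nat:
  "matpow_int_v A (- int k) x = (((*v) (matrix_inv A)) ^^ k) x"
  by (cases "k = 0") (simp_all add: matpow_int_v_def)

lemma matpow_int_v_succ:
  fixes A :: "real ^ 'n ^ 'n"
  assumes A: "invertible A"
  shows "matpow_int_v A (j + 1) x = A *v matpow_int_v A j x"
proof (cases "0 \<le> j")
  case True
  then have "nat (j + 1) = Suc (nat j)" by simp
  with True show ?thesis by (simp add: matpow_int_v_def)
next
  case False
  define k where "k = nat (- j - 1)"
  with False have j: "j = - int (Suc k)" by simp
  then have "matpow_int_v A j x = matrix_inv A *v (((*v) (matrix_inv A)) ^^ k) x"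
    by (simp only: matpow_int_v_uminus_of_nat funpow.simps(2) comp_def)
  moreover have "matpow_int_v A (j + 1) x = (((*v) (matrix_inv A)) ^^ k) x"
    using matpow_int_v_uminus_of_nat[of A k x] j by simp
  ultimately show ?thesis
    by (simp add: matrix_vector_mul_assoc matrix_inv_both_sides(1)[OF A])
qed

lemma matpow_int_v_add_of_nat:
  fixes A :: "real ^ 'n ^ 'n"
  assumes A: "invertible A"
  shows "matpow_int_v A (j + int n) x = (((*v) A) ^^ n) (matpow_int_v A j x)"
proof (induction n)
  case (Suc n)
  have "matpow_int_v A (j + int (Suc n)) x = matpow_int_v A ((j + int n) + 1) x"
    by (simp add: ac_simps)
  then show ?case by (simp add: matpow_int_v_succ[OF A] Suc.IH)
qed simp

lemma telescope_has_sum_int: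
  fixes f :: "int \<Rightarrow> real"
  assumes antimono: "\<And>j. f (j + 1) \<le> f j"
    and at_top: "(\<lambda>k. f (int k)) \<longlonglongrightarrow> a"
    and at_bot: "(\<lambda>k. f (- int k)) \<longlonglongrightarrow> b"
  shows "((\<lambda>j. f j - f (j + 1)) has_sum (b - a)) UNIV"
proof -
  let ?d = "\<lambda>j. f j - f (j + 1)"
  have d_nonneg: "0 \<le> ?d j" for j using antimono[of j] by simp
  have "(?d \<circ> int) sums (f 0 - a)"
    using telescope_sums'[OF at_top] by (simp add: comp_def ac_simps)
  then have "((?d \<circ> int) has_sum (f 0 - a)) UNIV"
    by (rule sums_nonneg_imp_has_sum) (unfold comp_def, rule d_nonneg)
  then have nonneg_part: "(?d has_sum (f 0 - a)) (range int)"
    by (simp add: has_sum_reindex)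
  have "(?d \<circ> (\<lambda>k. - int (Suc k))) sums (b - f 0)"
    using telescope_sums[OF at_bot] by (simp add: comp_def ac_simps)
  then have "((?d \<circ> (\<lambda>k. - int (Suc k))) has_sum (b - f 0)) UNIV"
    by (rule sums_nonneg_imp_has_sum) (unfold comp_def, rule d_nonneg)
  then have neg_part: "(?d has_sum (b - f 0)) (range (\<lambda>k. - int (Suc k)))"
    by (simp add: has_sum_reindex inj_on_def)
  have "range int \<inter> range (\<lambda>k. - int (Suc k)) = {}" by auto
  from has_sum_Un_disjoint[OF nonneg_part neg_part this]
  have "(?d has_sum (b - a)) (range int \<union> range (\<lambda>k. - int (Suc k)))" by simp
  moreover have "range int \<union> range (\<lambda>k. - int (Suc k)) = UNIV"
  proof -
    have "j \<in> range int \<union> range (\<lambda>k. - int (Suc k))" for j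
    proof (cases "0 \<le> j")
      case True
      then have "j = int (nat j)" by simp
      then show ?thesis by blast
    next
      case False
      then have "j = - int (Suc (nat (- j - 1)))" by simp
      then show ?thesis by blast
    qed
    then show ?thesis by blast
  qed
  ultimately show ?thesis by simp
qed

lemma crossing_index_exists:
  fixes s :: "int \<Rightarrow> real"
  assumes below: "s i < a" and above: "a \<le> s (i + int d)"
  shows "\<exists>j. s j < a \<and> a \<le> s (j + 1)"
  using above
proof (induction d)
  case 0
  then show ?case using below by simp
next
  case (Suc d)
  show ?case
  proof (cases "a \<le> s (i + int d)")
    case True
    then show ?thesis by (rule Suc.IH)
  next
    case False
    then show ?thesis using Suc.prems by (intro exI[of _ "i + int d"]) (simp add: ac_simps)
  qed
qed

lemma window_le_infsum_squares:
  fixes f :: "int \<Rightarrow> real"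
  assumes summable: "(\<lambda>j. (f j)\<^sup>2) summable_on UNIV"
    and c: "0 \<le> c" "c \<le> (\<Sum>t<L. f (i + int t))"
  shows "c\<^sup>2 / L \<le> (\<Sum>\<^sub>\<infinity>j. (f j)\<^sup>2)"
proof -
  have "c\<^sup>2 \<le> (\<Sum>t<L. f (i + int t))\<^sup>2"
    using c by (intro power_mono) auto
  also have "\<dots> \<le> (\<Sum>t<L. (f (i + int t))\<^sup>2) * L"
    using sum_squared_le_sum_of_squares[of "\<lambda>t. f (i + int t)" "{..<L}"] by simp
  finally have "c\<^sup>2 / L \<le> (\<Sum>t<L. (f (i + int t))\<^sup>2)"
    by (cases "L = 0") (simp_all add: divide_le_eq)
  also have "\<dots> = (\<Sum>j\<in>(\<lambda>t. i + int t) ` {..<L}. (f j)\<^sup>2)"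
    by (simp add: sum.reindex inj_on_def)
  also have "\<dots> \<le> (\<Sum>\<^sub>\<infinity>j. (f j)\<^sup>2)"
    by (rule finite_sum_le_infsum[OF summable]) simp_all
  finally show ?thesis .
qed

section \<open>Orbits of an expanding matrix\<close>

locale expanding_norm =
  fixes N :: "real ^ 'n \<Rightarrow> real" and A :: "real ^ 'n ^ 'n"
  assumes is_norm: "is_norm N" and expanding: "expanding A"
    and norm_le_norm_A: "\<And>x. N x \<le> N (A *v x)"
begin

lemma invertible: "invertible A"
  using expanding by (rule expanding_invertible)

lemma norm_le_norm_iterate: "N x \<le> N ((((*v) A) ^^ n) x)"
  by (induction n) (auto intro: order_trans norm_le_norm_A)

lemma norm_matpow_mono:
  assumes "i \<le> j"
  shows "N (matpow_int_v A i x) \<le> N (matpow_int_v A j x)"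
proof -
  have "j = i + int (nat (j - i))" using assms by simp
  then have "matpow_int_v A j x = (((*v) A) ^^ nat (j - i)) (matpow_int_v A i x)"
    by (metis matpow_int_v_add_of_nat[OF invertible])
  then show ?thesis by (simp add: norm_le_norm_iterate)
qed

lemma iterate_doubles_norm:
  obtains m where "\<And>k x. 2 ^ k * N x \<le> N ((((*v) A) ^^ (m * k)) x)"
proof -
  obtain m where m: "\<And>x. 2 * N x \<le> N ((((*v) A) ^^ m) x)"
    using expanding_iterate_norm_ge[OF is_norm expanding] by blast
  have "2 ^ k * N x \<le> N ((((*v) A) ^^ (m * k)) x)" for k x
  proof (induction k)
    case (Suc k)
    have "2 ^ Suc k * N x \<le> 2 * N ((((*v) A) ^^ (m * k)) x)" using Suc by simp
    also have "\<dots> \<le> N ((((*v) A) ^^ m) ((((*v) A) ^^ (m * k)) x))" by (rule m)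
    finally show ?case by (simp add: funpow_add)
  qed simp
  then show ?thesis by (rule that)
qed

lemma norm_matpow_at_top:
  assumes "x \<noteq> 0"
  shows "filterlim (\<lambda>k. N (matpow_int_v A (int k) x)) at_top sequentially"
  unfolding filterlim_at_top
proof
  fix Z :: real
  obtain m where m: "\<And>k x. 2 ^ k * N x \<le> N ((((*v) A) ^^ (m * k)) x)"
    using iterate_doubles_norm by blast
  have "0 < N x" using is_norm_pos[OF is_norm assms] .
  then obtain k0 where "Z / N x < 2 ^ k0" using real_arch_pow[of 2 "Z / N x"] by auto
  then have "Z \<le> 2 ^ k0 * N x" using \<open>0 < N x\<close> by (simp add: divide_less_eq)
  also have "\<dots> \<le> N (matpow_int_v A (int (m * k0)) x)"
    using m[of k0 x] by (simp only: matpow_int_v_of_nat)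
  finally have Z: "Z \<le> N (matpow_int_v A (int (m * k0)) x)" .
  show "\<forall>\<^sub>F k in sequentially. Z \<le> N (matpow_int_v A (int k) x)"
    by (rule eventually_sequentiallyI[of "m * k0"])
      (rule order_trans[OF Z norm_matpow_mono], simp del: of_nat_mult)
qed

lemma norm_matpow_at_bot: "(\<lambda>k. N (matpow_int_v A (- int k) x)) \<longlonglongrightarrow> 0"
proof (rule order_tendstoI)
  fix \<epsilon> :: real
  assume "\<epsilon> < 0"
  then have "\<epsilon> < N (matpow_int_v A (- int k) x)" for k
    using is_norm_nonneg[OF is_norm] by (rule less_le_trans)
  then show "\<forall>\<^sub>F k in sequentially. \<epsilon> < N (matpow_int_v A (- int k) x)"
    by simp
next
  fix \<epsilon> :: real
  assume "0 < \<epsilon>"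
  obtain m where m: "\<And>k x. 2 ^ k * N x \<le> N ((((*v) A) ^^ (m * k)) x)"
    using iterate_doubles_norm by blast
  obtain k0 where "N x / \<epsilon> < 2 ^ k0" using real_arch_pow[of 2 "N x / \<epsilon>"] by auto
  then have k0: "N x < 2 ^ k0 * \<epsilon>" using \<open>0 < \<epsilon>\<close> by (simp add: divide_less_eq)
  let ?y = "matpow_int_v A (- int (m * k0)) x"
  have "(((*v) A) ^^ (m * k0)) ?y = x"
    using matpow_int_v_add_of_nat[OF invertible, of "- int (m * k0)" "m * k0" x] by simp
  then have "2 ^ k0 * N ?y \<le> N x" using m[of k0 ?y] by simp
  with k0 have "2 ^ k0 * N ?y < 2 ^ k0 * \<epsilon>" by linarith
  then have small: "N ?y < \<epsilon>" by simp
  show "\<forall>\<^sub>F k in sequentially. N (matpow_int_v A (- int k) x) < \<epsilon>"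
    by (rule eventually_sequentiallyI[of "m * k0"])
      (rule le_less_trans[OF norm_matpow_mono small], simp del: of_nat_mult)
qed

lemma norm_matpow_uniform_window:
  assumes "0 < a"
  obtains L where "0 < L"
    and "\<And>x. x \<noteq> 0 \<Longrightarrow>
      \<exists>i. N (matpow_int_v A i x) < a \<and> b \<le> N (matpow_int_v A (i + int L) x)"
proof -
  obtain m where m: "\<And>k x. 2 ^ k * N x \<le> N ((((*v) A) ^^ (m * k)) x)"
    using iterate_doubles_norm by blast
  obtain k0 where "b / a < 2 ^ k0" using real_arch_pow[of 2 "b / a"] by auto
  then have k0: "b < 2 ^ k0 * a" using assms by (simp add: divide_less_eq)
  define L where "L = m * k0 + 1"
  have "\<exists>i. N (matpow_int_v A i x) < a \<and> b \<le> N (matpow_int_v A (i + int L) x)"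
    if x: "x \<noteq> 0" for x
  proof -
    let ?s = "\<lambda>j. N (matpow_int_v A j x)"
    obtain k1 where k1: "?s (- int k1) < a"
      using order_tendstoD(2)[OF norm_matpow_at_bot assms] by (auto simp: eventually_sequentially)
    obtain k2 where k2: "a \<le> ?s (int k2)"
      using norm_matpow_at_top[OF x] by (auto simp: filterlim_at_top eventually_sequentially)
    obtain i where i: "?s i < a" "a \<le> ?s (i + 1)"
      using crossing_index_exists[of ?s "- int k1" a "k1 + k2"] k1 k2 by auto
    have "2 ^ k0 * a \<le> 2 ^ k0 * ?s (i + 1)" using i(2) by simp
    with k0 have "b < 2 ^ k0 * ?s (i + 1)" by linarith
    also have "\<dots> \<le> N ((((*v) A) ^^ (m * k0)) (matpow_int_v A (i + 1) x))" by (rule m)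
    also have "\<dots> = ?s (i + int L)"
      using matpow_int_v_add_of_nat[OF invertible, of "i + 1" "m * k0" x]
      by (simp add: L_def ac_simps)
    finally show ?thesis using i(1) by (intro exI[of _ i]) simp
  qed
  then show ?thesis using that[of L] by (simp add: L_def)
qed

end

locale radial_profile = expanding_norm N A
  for N :: "real ^ 'n \<Rightarrow> real" and A :: "real ^ 'n ^ 'n" +
  fixes r :: "real \<Rightarrow> real"
  assumes r_continuous: "continuous_on {0..} r"
    and r_antimono: "\<And>s t. 0 \<le> s \<Longrightarrow> s \<le> t \<Longrightarrow> r t \<le> r s"
    and r_0: "r 0 = 1" and r_at_top: "(r \<longlongrightarrow> 0) at_top"
begin

definition g :: "real ^ 'n \<Rightarrow> real" where
  "g x = r (N x) - r (N (A *v x))"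

lemma r_nonneg:
  assumes "0 \<le> t"
  shows "0 \<le> r t"
proof (rule ccontr)
  assume "\<not> 0 \<le> r t"
  then have "\<forall>\<^sub>F u in at_top. r t < r u"
    using order_tendstoD(1)[OF r_at_top] by simp
  then obtain u where "t \<le> u" "r t < r u"
    unfolding eventually_at_top_linorder by (meson nle_le)
  with r_antimono[OF assms] show False by fastforce
qed

lemma r_le_1: "0 \<le> t \<Longrightarrow> r t \<le> 1"
  using r_antimono[of 0 t] r_0 by simp

lemma g_nonneg: "0 \<le> g x"
  using r_antimono[OF is_norm_nonneg[OF is_norm] norm_le_norm_A] by (simp add: g_def)

lemma g_le_1: "g x \<le> 1"
  using r_le_1[OF is_norm_nonneg[OF is_norm], of x]
    r_nonneg[OF is_norm_nonneg[OF is_norm], of "A *v x"]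
  by (simp add: g_def)

lemma g_square_le: "(g x)\<^sup>2 \<le> g x"
  using g_nonneg[of x] g_le_1[of x] by (simp add: power2_eq_square mult_left_le)

lemma g_matpow:
  "g (matpow_int_v A j x) = r (N (matpow_int_v A j x)) - r (N (matpow_int_v A (j + 1) x))"
  by (simp add: g_def matpow_int_v_succ[OF invertible])

lemma g_matpow_has_sum:
  assumes "x \<noteq> 0"
  shows "((\<lambda>j. g (matpow_int_v A j x)) has_sum 1) UNIV"
proof -
  let ?f = "\<lambda>j. r (N (matpow_int_v A j x))"
  have "?f (j + 1) \<le> ?f j" for j
    by (intro r_antimono is_norm_nonneg[OF is_norm] norm_matpow_mono) simp
  moreover have "(\<lambda>k. ?f (int k)) \<longlonglongrightarrow> 0"
    using filterlim_compose[OF r_at_top norm_matpow_at_top[OF assms]] .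
  moreover have "(\<lambda>k. ?f (- int k)) \<longlonglongrightarrow> 1"
    using continuous_on_tendsto_compose[OF r_continuous norm_matpow_at_bot]
    by (simp add: r_0 is_norm_nonneg[OF is_norm])
  ultimately show ?thesis
    using telescope_has_sum_int[of ?f 0 1] by (simp add: g_matpow)
qed

lemma g_matpow_square_summable:
  "x \<noteq> 0 \<Longrightarrow> (\<lambda>j. (g (matpow_int_v A j x))\<^sup>2) summable_on UNIV"
  by (rule summable_on_comparison_test[OF has_sum_imp_summable[OF g_matpow_has_sum]])
    (auto intro: g_square_le)

lemma g_matpow_square_infsum_le_1:
  assumes "x \<noteq> 0"
  shows "(\<Sum>\<^sub>\<infinity>j. (g (matpow_int_v A j x))\<^sup>2) \<le> 1"
proof -
  have "(\<Sum>\<^sub>\<infinity>j. (g (matpow_int_v A j x))\<^sup>2) \<le> (\<Sum>\<^sub>\<infinity>j. g (matpow_int_v A j x))"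
    by (intro infsum_mono g_matpow_square_summable has_sum_imp_summable[OF g_matpow_has_sum] assms
        g_square_le)
  also have "\<dots> = 1" using g_matpow_has_sum[OF assms] by (rule infsumI)
  finally show ?thesis .
qed

lemma r_near_0: "\<exists>a>0. 1 / 2 \<le> r a"
proof -
  have "(r \<longlongrightarrow> 1) (at 0 within {0..})"
    using r_continuous r_0 unfolding continuous_on_def by (metis atLeast_iff order_refl)
  then have "(r \<longlongrightarrow> 1) (at_right 0)"
    by (simp add: at_within_Ici_at_right)
  then have "\<forall>\<^sub>F t in at_right 0. 1 / 2 < r t"
    by (rule order_tendstoD) simp
  then obtain b where "0 < b" "\<And>t. 0 < t \<Longrightarrow> t < b \<Longrightarrow> 1 / 2 < r t"
    unfolding eventually_at_right_field by blast
  then have "1 / 2 < r (b / 2)" by simp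
  with \<open>0 < b\<close> show ?thesis by (intro exI[of _ "b / 2"]) simp
qed

lemma g_matpow_window_sum:
  "(\<Sum>t<L. g (matpow_int_v A (i + int t) x))
    = r (N (matpow_int_v A i x)) - r (N (matpow_int_v A (i + int L) x))"
proof -
  have "(\<Sum>t<L. g (matpow_int_v A (i + int t) x))
      = (\<Sum>t<L. r (N (matpow_int_v A (i + int t) x))
          - r (N (matpow_int_v A (i + int (Suc t)) x)))"
    by (simp add: g_matpow ac_simps)
  also have "\<dots> = r (N (matpow_int_v A i x)) - r (N (matpow_int_v A (i + int L) x))"
    by (subst sum_lessThan_telescope') simp
  finally show ?thesis .
qed

lemma g_matpow_window_sum_ge:
  obtains L where "0 < L"
    and "\<And>x. x \<noteq> 0 \<Longrightarrow> \<exists>i. 1 / 4 \<le> (\<Sum>t<L. g (matpow_int_v A (i + int t) x))"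
proof -
  obtain a where a: "0 < a" "1 / 2 \<le> r a" using r_near_0 by blast
  obtain b0 where b0: "\<And>t. b0 \<le> t \<Longrightarrow> r t < 1 / 4"
    using order_tendstoD(2)[OF r_at_top, of "1 / 4"] by (auto simp: eventually_at_top_linorder)
  define b where "b = max b0 a"
  obtain L where L: "0 < L" and window: "\<And>x. x \<noteq> 0 \<Longrightarrow>
      \<exists>i. N (matpow_int_v A i x) < a \<and> b \<le> N (matpow_int_v A (i + int L) x)"
    using norm_matpow_uniform_window[OF a(1)] by blast
  have "\<exists>i. 1 / 4 \<le> (\<Sum>t<L. g (matpow_int_v A (i + int t) x))" if x: "x \<noteq> 0" for x
  proof -
    let ?s = "\<lambda>j. N (matpow_int_v A j x)"
    obtain i where i: "?s i < a" "b \<le> ?s (i + int L)" using window[OF x] by blast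
    have "1 / 2 \<le> r (?s i)"
      using a r_antimono[of "?s i" a] i(1) is_norm_nonneg[OF is_norm] by simp
    moreover have "r (?s (i + int L)) \<le> r b"
      using a(1) i(2) by (intro r_antimono) (simp_all add: b_def)
    moreover have "r b < 1 / 4" by (rule b0) (simp add: b_def)
    ultimately show ?thesis
      unfolding g_matpow_window_sum by (intro exI[of _ i]) linarith
  qed
  with L show ?thesis by (rule that)
qed

lemma g_matpow_square_infsum_lower_bound:
  "\<exists>C>0. \<forall>x. x \<noteq> 0 \<longrightarrow> C \<le> (\<Sum>\<^sub>\<infinity>j. (g (matpow_int_v A j x))\<^sup>2)"
proof -
  obtain L where L: "0 < L"
    and window: "\<And>x. x \<noteq> 0 \<Longrightarrow> \<exists>i. 1 / 4 \<le> (\<Sum>t<L. g (matpow_int_v A (i + int t) x))"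
    using g_matpow_window_sum_ge by blast
  have "(1 / 4)\<^sup>2 / L \<le> (\<Sum>\<^sub>\<infinity>j. (g (matpow_int_v A j x))\<^sup>2)" if x: "x \<noteq> 0" for x
    using window[OF x] window_le_infsum_squares[OF g_matpow_square_summable[OF x]] by auto
  with L show ?thesis by (intro exI[of _ "(1 / 4)\<^sup>2 / real L"]) simp
qed

end

theorem proposition2p4:
  fixes N :: "real ^ 'n \<Rightarrow> real"
    and A :: "real ^ 'n ^ 'n"
    and r :: "real \<Rightarrow> real"
    and \<phi> g :: "real ^ 'n \<Rightarrow> real"
  assumes hN: "is_norm N"
    and hA: "expanding A"
    and hAN: "\<And>\<gamma>. N \<gamma> \<le> N (A *v \<gamma>)"
    and hrc: "continuous_on {0..} r"
    and hrd: "\<And>s t. 0 \<le> s \<Longrightarrow> s \<le> t \<Longrightarrow> r t \<le> r s"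
    and hr0: "r 0 = 1"
    and hrlim: "(r \<longlongrightarrow> 0) at_top"
    and h\<phi>: "\<And>\<gamma>. \<phi> \<gamma> = r (N \<gamma>)"
    and hg: "\<And>\<gamma>. g \<gamma> = \<phi> \<gamma> - \<phi> (A *v \<gamma>)"
  shows "(\<forall>\<gamma>. g \<gamma> \<ge> 0)
    \<and> (\<forall>\<gamma>. \<gamma> \<noteq> 0 \<longrightarrow> ((\<lambda>j. g (matpow_int_v A j \<gamma>)) has_sum 1) (UNIV :: int set))
    \<and> (\<exists>C > 0. \<forall>\<gamma>. \<gamma> \<noteq> 0 \<longrightarrow>
          C \<le> (\<Sum>\<^sub>\<infinity>j\<in>(UNIV :: int set). \<bar>g (matpow_int_v A j \<gamma>)\<bar>\<^sup>2)
          \<and> (\<Sum>\<^sub>\<infinity>j\<in>(UNIV :: int set). \<bar>g (matpow_int_v A j \<gamma>)\<bar>\<^sup>2) \<le> 1)"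
proof -
  interpret P: radial_profile N A r
    using hN hA hAN hrc hrd hr0 hrlim by unfold_locales
  have g_eq: "g = P.g"
    by (simp add: fun_eq_iff hg h\<phi> P.g_def)
  show ?thesis
    unfolding g_eq power2_abs
    using P.g_nonneg P.g_matpow_has_sum P.g_matpow_square_infsum_lower_bound
      P.g_matpow_square_infsum_le_1
    by blast
qed

end
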